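(* Let $\mathbb{V}$ be a vector space of finite dimension $n>1$ over a field $\mathbb{F}$, and suppose $n$ is even, $n=2m$. Let $\mathcal{W}[m-1]$ be the collection of all non-trivial subspaces of $\mathbb{V}$ of dimension less than or equal to $m-1$. Let $\alpha\in\mathbb{V}$ be a non-zero vector and let $\mathcal{W}^{\alpha}[m]$ be the collection of all non-trivial subspaces of $\mathbb{V}$ that contain $\alpha$ and have dimension $m$. Then $\mathcal{W}[m-1]\cup\mathcal{W}^{\alpha}[m]$ is a maximal independent set in the subspace sum graph $\mathcal{G}(\mathbb{V})$.
   Context: For a finite dimensional vector space $\mathbb{V}$ over a field $\mathbb{F}$ with $\dim(\mathbb{V})>1$, the subspace sum graph $\mathcal{G}(\mathbb{V})$ is the graph whose vertices are the non-trivial proper subspaces of $\mathbb{V}$ (subspaces $W$ with $W\neq\{0\}$ and $W\neq\mathbb{V}$), two vertices $W_1,W_2$ being adjacent if and only if $W_1+W_2=\mathbb{V}$. Non-trivial means different from $\{0\}$. A maximal independent set is an independent set (pairwise non-adjacent vertices) that is maximal with respect to inclusion. *)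

theory Defs
  imports "HOL.Vector_Spaces" "Graph_Theory.Pair_Digraph"
begin

text \<open>Undirected simple graphs are represented, as in \<^theory>\<open>Graph_Theory.Digraph\<close>, by
  symmetric loop-free digraphs; vertex sets may be infinite here.\<close>

definition independent_set :: "('a, 'b) pre_digraph \<Rightarrow> 'a set \<Rightarrow> bool" where
  "independent_set G S \<longleftrightarrow> S \<subseteq> verts G \<and> pairwise (\<lambda>u v. \<not> u \<rightarrow>\<^bsub>G\<^esub> v) S"

definition maximal_independent_set :: "('a, 'b) pre_digraph \<Rightarrow> 'a set \<Rightarrow> bool" where
  "maximal_independent_set G S \<longleftrightarrow>
     independent_set G S \<and> (\<forall>T. independent_set G T \<and> S \<subseteq> T \<longrightarrow> T = S)"

text \<open>The vector space is the whole type \<open>'v\<close> with scalar multiplication \<open>scale\<close>.\<close>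

definition subspace_sum_graph ::
    "('a::field \<Rightarrow> 'v::ab_group_add \<Rightarrow> 'v) \<Rightarrow> ('v set, 'v set \<times> 'v set) pre_digraph" where
  "subspace_sum_graph scale =
     (let V = {W. module.subspace scale W \<and> W \<noteq> {0} \<and> W \<noteq> UNIV}
      in with_proj \<lparr>pverts = V,
           parcs = {(W1, W2). W1 \<in> V \<and> W2 \<in> V \<and> {x + y |x y. x \<in> W1 \<and> y \<in> W2} = UNIV}\<rparr>)"

definition subspaces_dim_le ::
    "('a::field \<Rightarrow> 'v::ab_group_add \<Rightarrow> 'v) \<Rightarrow> nat \<Rightarrow> 'v set set" where
  "subspaces_dim_le scale k =
     {W. module.subspace scale W \<and> W \<noteq> {0} \<and> vector_space.dim scale W \<le> k}"

definition subspaces_dim_containing ::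
    "('a::field \<Rightarrow> 'v::ab_group_add \<Rightarrow> 'v) \<Rightarrow> 'v \<Rightarrow> nat \<Rightarrow> 'v set set" where
  "subspaces_dim_containing scale \<alpha> k =
     {W. module.subspace scale W \<and> W \<noteq> {0} \<and> \<alpha> \<in> W \<and> vector_space.dim scale W = k}"

lemma subspace_sum_graph_sym_loopfree:
  assumes "vector_space scale"
  shows "sym_digraph (subspace_sum_graph scale)" "loopfree_digraph (subspace_sum_graph scale)"
proof -
  let ?G = "subspace_sum_graph scale"
  interpret vs: vector_space scale by fact
  have sub: "{x + y |x y. x \<in> W \<and> y \<in> W} \<subseteq> W" if "vs.subspace W" for W
    using that vs.subspace_add by auto
  have comm: "{x + y |x y. x \<in> A \<and> y \<in> B} = {x + y |x y. x \<in> B \<and> y \<in> A}" for A B :: "'b set"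
    by (metis add.commute)
  have wf: "wf_digraph ?G"
    by unfold_locales (auto simp: subspace_sum_graph_def Let_def)
  have "arcs_ends ?G = {(W1, W2). W1 \<in> verts ?G \<and> W2 \<in> verts ?G
      \<and> {x + y |x y. x \<in> W1 \<and> y \<in> W2} = UNIV}"
    by (auto simp: subspace_sum_graph_def Let_def arcs_ends_conv)
  then have "symmetric ?G"
    unfolding symmetric_def sym_def using comm by auto
  then show "sym_digraph ?G"
    using wf by (simp add: wf_digraph.sym_digraphI)
  have "tail ?G e \<noteq> head ?G e" if e: "e \<in> arcs ?G" for e
  proof
    assume eq: "tail ?G e = head ?G e"
    obtain W1 W2 where "e = (W1, W2)" by fastforce
    with e eq have "vs.subspace W1" "W1 \<noteq> UNIV" "{x + y |x y. x \<in> W1 \<and> y \<in> W1} = UNIV"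
      by (simp_all add: subspace_sum_graph_def Let_def)
    with sub[of W1] show False by (simp add: top.extremum_unique)
  qed
  then show "loopfree_digraph ?G"
    using wf by (simp add: loopfree_digraph_def loopfree_digraph_axioms_def)
qed

end

theory Submission
  imports Defs
begin

text \<open>
  Write \<open>S\<close> for the family in question. Everything is controlled by the dimension formula
  \<open>dim (U + W) + dim (U \<inter> W) = dim U + dim W\<close>.

  Independence: two members of \<open>S\<close> have dimensions at most \<open>m\<close>, so they can only sum to the whole
  \<open>2m\<close>-dimensional space if both have dimension exactly \<open>m\<close> and meet trivially; but then both
  contain the non-zero vector \<open>\<alpha>\<close>, so they do not meet trivially.

  Maximality: a vertex \<open>W\<close> outside \<open>S\<close> has dimension above \<open>m\<close>, or has dimension \<open>m\<close> and avoids \<open>\<alpha>\<close>.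
  Every proper subspace has a complement through any prescribed vector outside it
  (\<open>complement_through\<close>). In the first case every complement has dimension at most \<open>m - 1\<close>; in the
  second case the complement through \<open>\<alpha>\<close> has dimension \<open>m\<close> and contains \<open>\<alpha>\<close>. Either way \<open>W\<close> is
  adjacent to a member of \<open>S\<close>, so \<open>W\<close> cannot be added.
\<close>

context finite_dimensional_vector_space
begin

text \<open>Equality forces the sum to be direct, so a common non-zero vector makes the bound strict.\<close>

lemma dim_UNIV_le_if_sums_UNIV:
  assumes "subspace U" "subspace W" and sum: "{x + y |x y. x \<in> U \<and> y \<in> W} = UNIV"
  shows "dim UNIV \<le> dim U + dim W"
    and "\<alpha> \<in> U \<Longrightarrow> \<alpha> \<in> W \<Longrightarrow> \<alpha> \<noteq> 0 \<Longrightarrow> dim UNIV < dim U + dim W"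
proof -
  have eq: "dim UNIV + dim (U \<inter> W) = dim U + dim W"
    using dim_sums_Int[OF assms(1,2)] sum by simp
  then show "dim UNIV \<le> dim U + dim W"
    by linarith
  assume "\<alpha> \<in> U" "\<alpha> \<in> W" "\<alpha> \<noteq> 0"
  then have "dim (U \<inter> W) \<noteq> 0"
    by auto
  with eq show "dim UNIV < dim U + dim W"
    by linarith
qed

text \<open>A basis of \<open>W\<close> stays independent when \<open>\<alpha>\<close> is added; the complement is spanned by what has
  to be added to the basis of \<open>W\<close> to extend this larger set to a basis of the whole space.\<close>

lemma complement_through:
  assumes "subspace W" "\<alpha> \<notin> W"
  obtains U where "subspace U" "\<alpha> \<in> U" "{x + y |x y. x \<in> W \<and> y \<in> U} = UNIV"
    "dim W + dim U = dim UNIV"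
proof -
  obtain B where B: "B \<subseteq> W" "independent B" "span B = W" "card B = dim W"
    using basis_subspace_exists[OF assms(1)] by blast
  define C where "C = extend_basis (insert \<alpha> B)"
  have ind: "independent (insert \<alpha> B)"
    using independent_insertI[OF _ B(2), of \<alpha>] B(3) assms(2) by blast
  have C: "insert \<alpha> B \<subseteq> C" "independent C" "span C = UNIV"
    unfolding C_def
    using ind by (rule extend_basis_superset independent_extend_basis span_extend_basis)+
  have fin: "finite C"
    using C(2) by (rule finiteI_independent)
  show thesis
  proof
    show "subspace (span (C - B))" by simp
    show "\<alpha> \<in> span (C - B)"
      using C(1) B(1) assms(2) by (auto intro: span_base)
    have BC: "B \<union> (C - B) = C" using C(1) by blast
    then show "{x + y |x y. x \<in> W \<and> y \<in> span (C - B)} = UNIV"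
      unfolding B(3)[symmetric] using span_Un[of B "C - B"] C(3) by metis
    have "independent (C - B)"
      using C(2) by (rule independent_mono) auto
    then have "dim (span (C - B)) = card (C - B)"
      by (rule dim_span_eq_card_independent)
    moreover have "card C = card B + card (C - B)"
      using fin BC card_Un_disjoint[of B "C - B"] finite_subset[of B C] by auto
    moreover have "dim UNIV = card C"
      using dim_span_eq_card_independent[OF C(2)] C(3) by simp
    ultimately show "dim W + dim (span (C - B)) = dim UNIV"
      using B(4) by linarith
  qed
qed

end

lemma verts_subspace_sum_graph:
  "verts (subspace_sum_graph scale) = {W. module.subspace scale W \<and> W \<noteq> {0} \<and> W \<noteq> UNIV}"
  by (simp add: subspace_sum_graph_def Let_def)

lemma dominates_subspace_sum_graph:
  "U \<rightarrow>\<^bsub>subspace_sum_graph scale\<^esub> W \<longleftrightarrow>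
     U \<in> verts (subspace_sum_graph scale) \<and> W \<in> verts (subspace_sum_graph scale) \<and>
     {x + y |x y. x \<in> U \<and> y \<in> W} = UNIV"
  by (auto simp: subspace_sum_graph_def Let_def arcs_ends_conv)

lemma maximal_independent_setI:
  assumes "independent_set G S"
    and "\<And>w. w \<in> verts G \<Longrightarrow> w \<notin> S \<Longrightarrow> \<exists>u\<in>S. w \<rightarrow>\<^bsub>G\<^esub> u"
  shows "maximal_independent_set G S"
  unfolding maximal_independent_set_def
proof (intro conjI allI impI)
  fix T
  assume T: "independent_set G T \<and> S \<subseteq> T"
  have "w \<in> S" if "w \<in> T" for w
  proof (rule ccontr)
    assume "w \<notin> S"
    moreover have "w \<in> verts G"
      using T \<open>w \<in> T\<close> by (auto simp: independent_set_def)
    ultimately obtain u where "u \<in> S" "w \<rightarrow>\<^bsub>G\<^esub> u"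
      using assms(2) by blast
    moreover have "w \<noteq> u" "u \<in> T"
      using \<open>u \<in> S\<close> \<open>w \<notin> S\<close> T by auto
    moreover have "pairwise (\<lambda>u v. \<not> u \<rightarrow>\<^bsub>G\<^esub> v) T"
      using T by (simp add: independent_set_def)
    ultimately show False
      using \<open>w \<in> T\<close> by (metis pairwiseD)
  qed
  with T show "T = S"
    by blast
qed (fact assms(1))

theorem theorem4p3:
  fixes scale :: "'a::field \<Rightarrow> 'v::ab_group_add \<Rightarrow> 'v"
    and Basis :: "'v set" and n m :: nat and \<alpha> :: 'v
  assumes "finite_dimensional_vector_space scale Basis"
    and "vector_space.dim scale (UNIV :: 'v set) = n"
    and "n > 1"
    and "n = 2 * m"
    and "\<alpha> \<noteq> 0"
  shows "maximal_independent_set (subspace_sum_graph scale)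
           (subspaces_dim_le scale (m - 1) \<union> subspaces_dim_containing scale \<alpha> m)"
proof -
  interpret finite_dimensional_vector_space scale Basis by fact
  let ?G = "subspace_sum_graph scale"
  let ?S = "subspaces_dim_le scale (m - 1) \<union> subspaces_dim_containing scale \<alpha> m"
  have dimV: "dim UNIV = 2 * m" and m: "m > 0"
    using assms by auto
  have S: "W \<in> ?S \<longleftrightarrow> subspace W \<and> W \<noteq> {0} \<and> (dim W < m \<or> dim W = m \<and> \<alpha> \<in> W)" for W
    using m by (auto simp: subspaces_dim_le_def subspaces_dim_containing_def)
  show ?thesis
  proof (rule maximal_independent_setI)
    have proper: "W \<noteq> UNIV" if "dim W < m \<or> dim W = m" for W
      using that dimV m by auto
    have "W \<in> verts ?G" if "W \<in> ?S" for W
      using that proper[of W] unfolding S verts_subspace_sum_graph by blast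
    then have "?S \<subseteq> verts ?G"
      by (rule subsetI)
    moreover have "\<not> U \<rightarrow>\<^bsub>?G\<^esub> W" if "U \<in> ?S" "W \<in> ?S" for U W
    proof
      assume "U \<rightarrow>\<^bsub>?G\<^esub> W"
      then have sum: "{x + y |x y. x \<in> U \<and> y \<in> W} = UNIV"
        by (simp add: dominates_subspace_sum_graph)
      have sub: "subspace U" "subspace W"
        using that unfolding S by blast+
      have UW: "dim U < m \<or> dim U = m \<and> \<alpha> \<in> U" "dim W < m \<or> dim W = m \<and> \<alpha> \<in> W"
        using that unfolding S by blast+
      have "2 * m \<le> dim U + dim W"
        using dim_UNIV_le_if_sums_UNIV(1)[OF sub sum] dimV by linarith
      with UW have eq: "dim U + dim W = 2 * m" and "\<alpha> \<in> U" "\<alpha> \<in> W"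
        by linarith+
      with dim_UNIV_le_if_sums_UNIV(2)[OF sub sum _ _ assms(5)] dimV show False
        by linarith
    qed
    ultimately show "independent_set ?G ?S"
      unfolding independent_set_def pairwise_def by blast
  next
    fix W
    assume W: "W \<in> verts ?G" "W \<notin> ?S"
    then have sub: "subspace W" and "W \<noteq> {0}" "W \<noteq> UNIV"
      by (auto simp: verts_subspace_sum_graph)
    with W(2) have dimW: "dim W > m \<or> dim W = m \<and> \<alpha> \<notin> W"
      unfolding S by linarith
    \<comment> \<open>For large \<open>W\<close> any vector outside \<open>W\<close> serves; in the middle dimension it must be \<open>\<alpha>\<close>.\<close>
    obtain \<beta> where \<beta>: "\<beta> \<notin> W" "dim W = m \<Longrightarrow> \<beta> = \<alpha>"
      using dimW \<open>W \<noteq> UNIV\<close> by blast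
    obtain U where U: "subspace U" "\<beta> \<in> U" "{x + y |x y. x \<in> W \<and> y \<in> U} = UNIV"
      and dimU: "dim W + dim U = dim UNIV"
      using complement_through[OF sub \<beta>(1)] by blast
    have "0 \<in> W"
      using sub by (rule subspace_0)
    with U(2) \<beta>(1) have "U \<noteq> {0}"
      by auto
    moreover have "dim U < m \<or> dim U = m \<and> \<alpha> \<in> U"
      using dimW dimU dimV \<beta>(2) U(2) by auto
    ultimately have "U \<in> ?S"
      using U(1) unfolding S by blast
    moreover have "U \<noteq> UNIV"
      using dimW dimU m by (auto simp del: dim_eq_0)
    then have "U \<in> verts ?G"
      using \<open>U \<noteq> {0}\<close> U(1) unfolding verts_subspace_sum_graph by blast
    ultimately show "\<exists>U\<in>?S. W \<rightarrow>\<^bsub>?G\<^esub> U"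
      using W(1) U(3) unfolding dominates_subspace_sum_graph by blast
  qed
qed

end
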